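(* There exists an absolute constant $K>0$ such that for all positive integers $r$ and $N$ there exists an $r$-colouring $C_1\cup\dots\cup C_r=\{1,2,\dots,N\}$ for which the number of triples $(x,y,z)$ with $x-y=z^2$ and such that $x,y,z$ all lie in the same colour class is at most $K N^{3/2^r}$.
   Context: An $r$-colouring of a set is a partition of it into $r$ (possibly empty) parts, called colour classes. *)

theory Defs
  imports Complex_Main "HOL-Library.Disjoint_Sets"
begin

text \<open>Only the values \<open>C i\<close> with \<open>i \<in> {1..r}\<close> matter; colour classes may be empty.\<close>

definition is_colouring :: "nat \<Rightarrow> 'a set \<Rightarrow> (nat \<Rightarrow> 'a set) \<Rightarrow> bool" where
  "is_colouring r A C \<longleftrightarrow> (\<Union>i\<in>{1..r}. C i) = A \<and> disjoint_family_on C {1..r}"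

text \<open>The elements are integers rather than naturals so that \<open>x - y\<close> is not truncated.\<close>

definition mono_triples :: "nat \<Rightarrow> (nat \<Rightarrow> int set) \<Rightarrow> (int \<times> int \<times> int) set" where
  "mono_triples r C =
     {(x, y, z). x - y = z ^ 2 \<and> (\<exists>i\<in>{1..r}. x \<in> C i \<and> y \<in> C i \<and> z \<in> C i)}"

end

theory Submission
  imports Defs "HOL-Library.Discrete_Functions"
begin

text \<open>
  A block of integers between \<open>\<lfloor>\<surd>N\<rfloor> + 1\<close> and \<open>N\<close> contains no triple at all: every \<open>z\<close> in it has
  \<open>z\<^sup>2 > N\<close>, whereas a difference of two of its elements is smaller than \<open>N\<close>. So one colour spent on
  this block reduces the problem on \<open>{1..N}\<close> with \<open>r + 1\<close> colours to the problem on \<open>{1..\<lfloor>\<surd>N\<rfloor>}\<close>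
  with \<open>r\<close> colours, and each such step halves the exponent of \<open>N\<close> in the bound. With a single
  colour left, \<open>x\<close> and \<open>z\<close> determine the triple and \<open>z \<le> \<surd>N\<close>, which gives the trivial bound
  \<open>N\<^bsup>3/2\<^esup>\<close>. The final classes are thus the successive blocks between
  \<open>N\<^bsup>1/2\<^esup>\<close>, \<open>N\<^bsup>1/4\<^esup>\<close>, \<open>N\<^bsup>1/8\<^esup>\<close> and so on, and the constant \<open>K = 1\<close> works.
\<close>

lemma floor_sqrt_le_powr_half: "real (floor_sqrt N) \<le> real N powr (1/2)"
proof -
  have "real (floor_sqrt N) ^ 2 \<le> real N"
    using floor_sqrt_power2_le[of N] by (metis of_nat_le_iff of_nat_power)
  then have "real (floor_sqrt N) \<le> sqrt (real N)"
    by (rule real_le_rsqrt)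
  then show ?thesis
    by (simp add: powr_half_sqrt)
qed

lemma less_square_of_floor_sqrt_less:
  assumes "int (floor_sqrt N) < z"
  shows "int N < z ^ 2"
proof -
  have "int N < int ((Suc (floor_sqrt N)) ^ 2)"
    using Suc_floor_sqrt_power2_gt[of N] by (simp only: of_nat_less_iff)
  also have "\<dots> = (int (floor_sqrt N) + 1) ^ 2"
    by (simp add: add.commute)
  also have "\<dots> \<le> z ^ 2"
    using assms by (intro power_mono) auto
  finally show ?thesis .
qed

lemma square_ne_diff_above_floor_sqrt:
  assumes "x \<in> {int (floor_sqrt N) + 1..int N}" "y \<in> {int (floor_sqrt N) + 1..int N}"
    and "z \<in> {int (floor_sqrt N) + 1..int N}"
  shows "x - y \<noteq> z ^ 2"
  using less_square_of_floor_sqrt_less[of N z] assms by auto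

lemma card_mono_triples_one_colour:
  assumes "C 1 = {1..int N}"
  shows "real (card (mono_triples 1 C)) \<le> real N powr (3/2)"
proof -
  let ?M = "floor_sqrt N"
  let ?f = "\<lambda>(x, z). (x, x - z ^ 2, z) :: int \<times> int \<times> int"
  let ?P = "{1..int N} \<times> {1..int ?M}"
  have "mono_triples 1 C \<subseteq> ?f ` ?P"
  proof
    fix t assume "t \<in> mono_triples 1 C"
    then obtain x y z where t: "t = (x, y, z)" and eq: "x - y = z ^ 2"
      and mem: "x \<in> {1..int N}" "y \<in> {1..int N}" "z \<in> {1..int N}"
      using assms by (auto simp: mono_triples_def)
    have "z ^ 2 \<le> int N"
      using eq mem by auto
    then have "z \<le> int ?M"
      using less_square_of_floor_sqrt_less[of N z] by linarith
    then have "(x, z) \<in> ?P" "t = ?f (x, z)"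
      using mem eq t by auto
    then show "t \<in> ?f ` ?P"
      by blast
  qed
  then have "card (mono_triples 1 C) \<le> card ?P"
    by (rule surj_card_le[rotated]) simp
  then have "card (mono_triples 1 C) \<le> N * ?M"
    by (simp add: card_cartesian_product)
  then have "real (card (mono_triples 1 C)) \<le> real N * real ?M"
    by (metis of_nat_le_iff of_nat_mult)
  also have "\<dots> \<le> real N powr 1 * real N powr (1/2)"
    using floor_sqrt_le_powr_half[of N] by (simp add: mult_left_mono)
  also have "\<dots> = real N powr (3/2)"
    by (subst powr_add[symmetric]) simp
  finally show ?thesis .
qed

lemma is_colouring_Suc:
  assumes "is_colouring r A C" "A \<inter> B = {}"
  shows "is_colouring (Suc r) (A \<union> B) (C(Suc r := B))"
proof -
  have "C i \<subseteq> A" if "i \<in> {1..r}" for i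
    using assms(1) that by (auto simp: is_colouring_def)
  then show ?thesis
    using assms
    by (auto simp: is_colouring_def atLeastAtMostSuc_conv disjoint_family_on_def; blast)
qed

lemma mono_triples_Suc:
  assumes "\<And>x y z. x \<in> B \<Longrightarrow> y \<in> B \<Longrightarrow> z \<in> B \<Longrightarrow> x - y \<noteq> z ^ 2"
  shows "mono_triples (Suc r) (C(Suc r := B)) = mono_triples r C"
  using assms by (auto simp: mono_triples_def atLeastAtMostSuc_conv)

text \<open>
  The induction on the number of colours has to range over all \<open>N\<close>, since its step passes from
  \<open>N\<close> to \<open>\<lfloor>\<surd>N\<rfloor>\<close>. Keeping the constant equal to 1 throughout is what makes it independent of \<open>r\<close>.
\<close>

lemma exists_colouring_few_mono_triples:
  assumes "r \<ge> 1"
  shows "\<exists>C. is_colouring r {1..int N} C \<and>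
           real (card (mono_triples r C)) \<le> real N powr (3 / 2 ^ r)"
  using assms
proof (induction r arbitrary: N rule: dec_induct)
  case base
  let ?C = "\<lambda>_::nat. {1..int N}"
  have "is_colouring 1 {1..int N} ?C"
    by (simp add: is_colouring_def disjoint_family_on_def)
  then show ?case
    using card_mono_triples_one_colour[of ?C N] by auto
next
  case (step r)
  let ?M = "floor_sqrt N"
  let ?B = "{int ?M + 1..int N}"
  obtain C where C: "is_colouring r {1..int ?M} C"
    and card: "real (card (mono_triples r C)) \<le> real ?M powr (3 / 2 ^ r)"
    using step.IH by blast
  have "{1..int ?M} \<union> ?B = {1..int N}"
    using floor_sqrt_le[of N] by auto
  then have col: "is_colouring (Suc r) {1..int N} (C(Suc r := ?B))"
    using is_colouring_Suc[OF C, of ?B] by auto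
  have "mono_triples (Suc r) (C(Suc r := ?B)) = mono_triples r C"
    using square_ne_diff_above_floor_sqrt by (rule mono_triples_Suc)
  then have "real (card (mono_triples (Suc r) (C(Suc r := ?B)))) \<le> real ?M powr (3 / 2 ^ r)"
    using card by simp
  also have "\<dots> \<le> (real N powr (1/2)) powr (3 / 2 ^ r)"
    using floor_sqrt_le_powr_half by (intro powr_mono2) auto
  also have "\<dots> = real N powr (3 / 2 ^ Suc r)"
    by (simp add: powr_powr)
  finally show ?case
    using col by blast
qed

theorem proposition1p2:
  "\<exists>K::real. K > 0 \<and>
     (\<forall>r N::nat. r \<ge> 1 \<longrightarrow> N \<ge> 1 \<longrightarrow>
        (\<exists>C. is_colouring r {1..int N} C \<and>
             real (card (mono_triples r C)) \<le> K * real N powr (3 / 2 ^ r)))"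
  using exists_colouring_few_mono_triples by (intro exI[of _ 1]) simp

end
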